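(* Let $f(z)=h(z)+\overline{g(z)}=\sum_{k=0}^{\infty}a_kz^k+\overline{\sum_{k=1}^{\infty}b_kz^k}$ be a harmonic entire mapping of order $\rho$. Let $\{n_p\}_{p=1}^{\infty}$ be a strictly increasing sequence of nonnegative integers such that for every $p$ $$\frac{f^{(n_p)}-n_p!\,a_{n_p}-n_p!\,\overline{b_{n_p}}}{(n_p+1)!\,a_{n_p+1}}\in\mathcal{S}_H^{c}\quad\text{if }|a_{n_p+1}|\ge|b_{n_p+1}|,$$ and $$\frac{\overline{f^{(n_p)}}-n_p!\,\overline{a_{n_p}}-n_p!\,b_{n_p}}{(n_p+1)!\,b_{n_p+1}}\in\mathcal{S}_H^{c}\quad\text{if }|a_{n_p+1}|\le|b_{n_p+1}|.$$ Then $$\rho\le\frac{1}{\displaystyle 1-\limsup_{p\to\infty}\frac{\log(n_p-n_{p-1})}{\log n_p}}.$$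
   Context: Let $\mathbb{D}=\{z\in\mathbb{C}:|z|<1\}$. A harmonic mapping $F=H+\overline{G}$ ($H,G$ analytic) is sense-preserving if $G'=\omega H'$ for some analytic $\omega$ with $|\omega|<1$ and $F$ is nonconstant. $\mathcal{S}_H$ is the class of all univalent (injective) sense-preserving harmonic mappings $F=H+\overline{G}$ in $\mathbb{D}$ with $H(z)=z+\sum_{n=2}^{\infty}A_nz^n$ and $G(z)=\sum_{n=1}^{\infty}B_nz^n$. $\mathcal{S}_H^{c}$ is the family of $F\in\mathcal{S}_H$ whose coefficients satisfy $|A_n|<\frac{2n^2+1}{3}$ and $|B_n|<\frac{2n^2+1}{3}$ for all $n\ge2$ (functions are restricted to $\mathbb{D}$ when testing membership). For $n\ge0$, $f^{(n)}:=h^{(n)}+\overline{g^{(n)}}$ (with $f^{(0)}=f$), and $b_0=0$. A harmonic entire mapping is a complex-valued harmonic function on $\mathbb{C}$, written $f=h+\overline g$ with $h,g$ entire and $g(0)=0$; with $M(r,f)=\max_{|z|=r}|f(z)|$ its order is $\rho=\limsup_{r\to\infty}\frac{\log\log M(r,f)}{\log r}\in[0,\infty]$. If the limsup in the bound equals $1$, the right-hand side is interpreted as $\infty$. *)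

theory Defs
  imports "HOL-Complex_Analysis.Complex_Analysis"
begin

definition harmonic_decomp ::
  "complex set \<Rightarrow> (complex \<Rightarrow> complex) \<Rightarrow> (complex \<Rightarrow> complex) \<Rightarrow> (complex \<Rightarrow> complex) \<Rightarrow> bool" where
  "harmonic_decomp S F H G \<longleftrightarrow>
     H holomorphic_on S \<and> G holomorphic_on S \<and> (\<forall>z\<in>S. F z = H z + cnj (G z))"

definition sense_preserving ::
  "complex set \<Rightarrow> (complex \<Rightarrow> complex) \<Rightarrow> (complex \<Rightarrow> complex) \<Rightarrow> (complex \<Rightarrow> complex) \<Rightarrow> bool" where
  "sense_preserving S F H G \<longleftrightarrow>
     harmonic_decomp S F H G \<and> \<not> F constant_on S \<and>
     (\<exists>\<omega>. \<omega> holomorphic_on S \<and>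
       (\<forall>z\<in>S. norm (\<omega> z) < 1 \<and> deriv G z = \<omega> z * deriv H z))"

text \<open>
  Elements of the classes below are total functions; only their values on the unit disc matter.
  The coefficient sequences are uniquely determined by \<open>F\<close>, because \<open>B 0 = 0\<close>.
\<close>

definition SH_coeffs :: "(complex \<Rightarrow> complex) \<Rightarrow> (nat \<Rightarrow> complex) \<Rightarrow> (nat \<Rightarrow> complex) \<Rightarrow> bool" where
  "SH_coeffs F A B \<longleftrightarrow>
     (\<exists>H G. sense_preserving (ball 0 1) F H G \<and>
       A 0 = 0 \<and> A 1 = 1 \<and> B 0 = 0 \<and>
       (\<forall>z\<in>ball 0 1. (\<lambda>n. A n * z ^ n) sums H z \<and> (\<lambda>n. B n * z ^ n) sums G z))"

definition SH :: "(complex \<Rightarrow> complex) set" where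
  "SH = {F. inj_on F (ball 0 1) \<and> (\<exists>A B. SH_coeffs F A B)}"

definition SHc :: "(complex \<Rightarrow> complex) set" where
  "SHc = {F \<in> SH. \<exists>A B. SH_coeffs F A B \<and>
     (\<forall>n\<ge>2. norm (A n) < (2 * (real n)\<^sup>2 + 1) / 3 \<and> norm (B n) < (2 * (real n)\<^sup>2 + 1) / 3)}"

definition harmonic_entire ::
  "(complex \<Rightarrow> complex) \<Rightarrow> (complex \<Rightarrow> complex) \<Rightarrow> (complex \<Rightarrow> complex) \<Rightarrow> bool" where
  "harmonic_entire f h g \<longleftrightarrow> harmonic_decomp UNIV f h g \<and> g 0 = 0"

text \<open>The \<open>n\<close>-th derivative of the harmonic mapping \<open>h + cnj g\<close>.\<close>

definition harmonic_deriv ::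
  "nat \<Rightarrow> (complex \<Rightarrow> complex) \<Rightarrow> (complex \<Rightarrow> complex) \<Rightarrow> complex \<Rightarrow> complex" where
  "harmonic_deriv n h g z = (deriv ^^ n) h z + cnj ((deriv ^^ n) g z)"

definition max_modulus :: "real \<Rightarrow> (complex \<Rightarrow> complex) \<Rightarrow> real" where
  "max_modulus r f = (SUP z\<in>sphere 0 r. norm (f z))"

text \<open>
  A nonconstant harmonic entire mapping is unbounded, so both logarithms are eventually taken
  of positive numbers.  For constant mappings the quotient tends to \<open>0\<close> in any case, whatever
  \<open>ln\<close> returns on nonpositive arguments.
\<close>

definition growth_order :: "(complex \<Rightarrow> complex) \<Rightarrow> ereal" where
  "growth_order f = Limsup at_top (\<lambda>r::real. ereal (ln (ln (max_modulus r f)) / ln r))"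

end

theory Submission
  imports Defs "HOL-Real_Asymp.Real_Asymp"
begin

text \<open>
  Put \<open>c m = max \<bar>a m\<bar> \<bar>b m\<bar>\<close> and \<open>d m = m! * c m\<close>.  Since the analytic and co-analytic parts of a
  harmonic mapping are unique up to constants, membership in the class bounds the Taylor
  coefficients of the \<open>n p\<close>-th derivative: \<open>d (n p + k) \<le> k! * k\<^sup>2 * d (n p + 1)\<close>.  Chaining these
  estimates over the gaps \<open>q = n (p + 1) - n p\<close>, where eventually \<open>ln q \<le> \<tau> * ln (n (p + 1))\<close> for any
  \<open>\<tau> > L\<close>, gives \<open>ln (d m) \<le> \<tau> * m * ln m + O(m)\<close>, hence by Stirling
  \<open>ln (c m) \<le> - (1 - \<tau>) * m * ln m + O(m)\<close>, and a power series with such coefficients has order at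
  most \<open>1 / (1 - \<tau>)\<close>.
\<close>

section \<open>Elementary estimates for factorials\<close>

text \<open>The half of Stirling's formula that is used: \<open>m ^ m / m!\<close> is a single term
  of the nonnegative series for \<open>exp m\<close>.\<close>

lemma power_fact_le_exp: "real m ^ m \<le> exp (real m) * fact m"
proof -
  have "(\<lambda>k. real m ^ k /\<^sub>R fact k) sums exp (real m)" by (rule exp_converges)
  then have "(\<Sum>k\<in>{m}. real m ^ k /\<^sub>R fact k) \<le> exp (real m)"
    using sum_le_suminf[of "\<lambda>k. real m ^ k /\<^sub>R fact k" "{m}"] by (simp add: sums_iff)
  then show ?thesis by (simp add: field_simps)
qed

lemma fact_le_exp: "fact k \<le> exp (real k * ln (real k))"
proof (cases "k = 0")
  case False
  have "fact k \<le> real (k ^ k)" by (rule fact_le_power)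
  also have "\<dots> = exp (real k * ln (real k))" using False by (simp add: exp_of_nat_mult)
  finally show ?thesis .
qed simp

lemma fact_sq_le_exp:
   "fact k * (real k)\<^sup>2 \<le> exp (real k * ln (real k) + 2 * real k)"
proof -
  have "real k \<le> exp (real k)" using exp_ge_add_one_self[of "real k"] by linarith
  then have "(real k)\<^sup>2 \<le> (exp (real k))\<^sup>2" by (intro power_mono) auto
  also have "\<dots> = exp (2 * real k)" by (simp add: exp_double)
  finally show ?thesis unfolding exp_add using fact_le_exp[of k] by (intro mult_mono) auto
qed

text \<open>Passing from index \<open>n p + 1\<close> to \<open>n (Suc p) + 1\<close> costs this
  factor with \<open>q\<close> the gap. The gap hypothesis controls \<open>ln q\<close>, not
  \<open>ln (q + 1)\<close>, so the cube of \<open>q + 1\<close> is absorbed into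
  \<open>exp (3 * q)\<close>.\<close>

lemma fact_Suc_sq_le_exp:
   "fact (Suc q) * (real (Suc q))\<^sup>2 \<le> exp (real q * ln (real q) + 3 * real q)"
proof -
  have "real (Suc q) \<le> exp (real q)" using exp_ge_add_one_self[of "real q"] by simp
  then have "(real (Suc q))^3 \<le> (exp (real q))^3" by (intro power_mono) auto
  also have "\<dots> = exp (3 * real q)" by (metis exp_of_nat_mult of_nat_numeral)
  finally have "fact q * (real (Suc q))^3 \<le> exp (real q * ln (real q)) * exp (3 * real q)"
    using fact_le_exp[of q] by (intro mult_mono) auto
  then show ?thesis by (simp add: exp_add power2_eq_square power3_eq_cube algebra_simps)
qed

section \<open>Growth of the scaled coefficients across the gaps\<close>

text \<open>Induction along the indices \<open>n p + 1\<close> gives the bound there, since the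
  exponents add up: a gap \<open>q\<close> contributes at most \<tau> * q * ln (n (Suc p)) plus a
  linear term, and n p + q = n (Suc p). A general \<open>m\<close> lies in one gap and needs one
  further application of \<open>step\<close>; \<open>dbl\<close> then lets \<open>ln m\<close>
  replace \<open>ln (n (Suc p))\<close>.\<close>

lemma gap_growth:
  fixes d :: "nat \<Rightarrow> real" and n :: "nat \<Rightarrow> nat"
  assumes d0: "\<And>m. d m \<ge> 0"
    and mono: "\<And>p. p \<ge> P \<Longrightarrow> n p < n (Suc p)"
    and pos: "n P > 0"
    and step: "\<And>p k. p \<ge> P \<Longrightarrow> k \<ge> 1 \<Longrightarrow> d (n p + k) \<le> fact k * (real k)\<^sup>2 * d (n p + 1)"
    and gap: "\<And>p. p \<ge> P \<Longrightarrow> ln (real (n (Suc p) - n p)) \<le> \<tau> * ln (real (n (Suc p)))"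
    and dbl: "\<And>p. p \<ge> P \<Longrightarrow> n (Suc p) \<le> 2 * n p"
    and tau: "0 \<le> \<tau>" "\<tau> \<le> 1"
    and m: "m > n P"
  shows "d m \<le> d (n P + 1) * exp (\<tau> * real m * ln (real m) + 3 * real m)"
proof -
  define D where "D = d (n P + 1)"
  have D: "D \<ge> 0" by (simp add: D_def d0)
  have mon: "n P \<le> n p" if "p \<ge> P" for p
    using that by (induction p rule: dec_induct) (auto dest!: mono)
  have step1: "d (n p + 1) \<le> D * exp (\<tau> * real (n p) * ln (real (n p)) + 3 * real (n p))" if "p \<ge> P" for p
    using that
  proof (induction p rule: dec_induct)
    case base
    have "exp (\<tau> * real (n P) * ln (real (n P)) + 3 * real (n P)) \<ge> 1"
      using tau pos by simp
    then show ?case using D mult_left_mono[of 1 _ D] by (simp add: D_def)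
  next
    case (step p)
    define q where "q = n (Suc p) - n p"
    have nq: "n (Suc p) = n p + q" using mono[OF step(1)] by (simp add: q_def)
    have np: "n p > 0" using mon[OF step(1)] pos by simp
    have "d (n (Suc p) + 1) = d (n p + Suc q)" by (simp add: nq)
    also have "\<dots> \<le> fact (Suc q) * (real (Suc q))\<^sup>2 * d (n p + 1)"
      by (rule assms(4)) (use step in auto)
    also have "\<dots> \<le> exp (real q * ln (real q) + 3 * real q)
          * (D * exp (\<tau> * real (n p) * ln (real (n p)) + 3 * real (n p)))"
      by (intro mult_mono fact_Suc_sq_le_exp step.IH d0) auto
    also have "\<dots> = D * exp (real q * ln (real q) + 3 * real q + (\<tau> * real (n p) * ln (real (n p)) + 3 * real (n p)))"
      unfolding exp_add by (simp add: mult_ac)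
    also have "\<dots> \<le> D * exp (\<tau> * real (n (Suc p)) * ln (real (n (Suc p))) + 3 * real (n (Suc p)))"
    proof (intro mult_left_mono D)
      \<comment> \<open>Both logarithms are raised to \<open>ln (n (Suc p))\<close>, so that their
        weights \<open>q\<close> and \<open>n p\<close> can be added.\<close>
      have "real q * ln (real q) \<le> real q * (\<tau> * ln (real (n (Suc p))))"
        using gap[OF step(1)] by (intro mult_left_mono) (auto simp: q_def)
      moreover have "\<tau> * real (n p) * ln (real (n p)) \<le> \<tau> * real (n p) * ln (real (n (Suc p)))"
        using tau np nq by (intro mult_left_mono) auto
      ultimately have "real q * ln (real q) + 3 * real q + (\<tau> * real (n p) * ln (real (n p)) + 3 * real (n p))
        \<le> \<tau> * (real (n p) + real q) * ln (real (n (Suc p))) + 3 * (real (n p) + real q)"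
        by (simp add: algebra_simps)
      then show "exp (real q * ln (real q) + 3 * real q + (\<tau> * real (n p) * ln (real (n p)) + 3 * real (n p)))
        \<le> exp (\<tau> * real (n (Suc p)) * ln (real (n (Suc p))) + 3 * real (n (Suc p)))"
        by (simp add: nq)
    qed
    finally show ?case .
  qed
  have "\<exists>p\<ge>P. n p < m \<and> m \<le> n (Suc p)"
  proof -
    have unb: "n (P + j) \<ge> j" for j
      by (induction j) (use mono[of "P + j" for j] in \<open>auto intro: Suc_leI le_less_trans\<close>)
    \<comment> \<open>Since \<open>m > n P\<close>, the least such \<open>j\<close> is positive, and
      its predecessor gives the left end of the gap containing \<open>m\<close>.\<close>
    define j where "j = (LEAST j. m \<le> n (P + j))"
    have j: "m \<le> n (P + j)" unfolding j_def by (rule LeastI[of _ m]) (rule unb)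
    then have "j \<noteq> 0" using m by (metis add.right_neutral leD)
    then obtain i where i: "j = Suc i" by (metis not0_implies_Suc)
    have "\<not> m \<le> n (P + i)" using not_less_Least[of i "\<lambda>j. m \<le> n (P + j)"] i by (auto simp: j_def)
    then show ?thesis using j i by (intro exI[of _ "P + i"]) auto
  qed
  then obtain p where p: "p \<ge> P" "n p < m" "m \<le> n (Suc p)" by blast
  define k where "k = m - n p"
  have k: "m = n p + k" "k \<ge> 1" using p by (auto simp: k_def)
  have np: "n p > 0" using mon[OF p(1)] pos by simp
  have "d m \<le> fact k * (real k)\<^sup>2 * d (n p + 1)" unfolding k(1) by (rule step[OF p(1) k(2)])
  also have "\<dots> \<le> exp (real k * ln (real k) + 2 * real k)
          * (D * exp (\<tau> * real (n p) * ln (real (n p)) + 3 * real (n p)))"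
    by (intro mult_mono fact_sq_le_exp step1 d0 p) auto
  also have "\<dots> = D * exp (real k * ln (real k) + 2 * real k + (\<tau> * real (n p) * ln (real (n p)) + 3 * real (n p)))"
    unfolding exp_add by (simp add: mult_ac)
  also have "\<dots> \<le> D * exp (\<tau> * real m * ln (real m) + 3 * real m)"
  proof (intro mult_left_mono D)
    \<comment> \<open>Doubling gives n (Suc p) <= 2 * m. The resulting \<tau> * ln 2 is at most 1,
      which turns the \<open>2 * k\<close> of \<open>fact_sq_le_exp\<close> into
      \<open>3 * k\<close>.\<close>
    have "ln (real k) \<le> ln (real (n (Suc p) - n p))" using k p by (simp add: k_def)
    also have "\<dots> \<le> \<tau> * ln (real (n (Suc p)))" by (rule gap[OF p(1)])
    also have "\<dots> \<le> \<tau> * ln (2 * real m)"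
    proof (intro mult_left_mono tau)
      have "real (n (Suc p)) \<le> 2 * real m" using dbl[OF p(1)] p by linarith
      then show "ln (real (n (Suc p))) \<le> ln (2 * real m)" using p by (subst ln_le_cancel_iff) auto
    qed
    also have "\<dots> = \<tau> * ln 2 + \<tau> * ln (real m)" using p by (simp add: ln_mult algebra_simps)
    also have "\<tau> * ln 2 \<le> 1 * 1" using tau ln_le_minus_one[of "2::real"] by (intro mult_mono) auto
    finally have "real k * ln (real k) \<le> real k * (1 + \<tau> * ln (real m))"
      by (intro mult_left_mono) auto
    moreover have "\<tau> * real (n p) * ln (real (n p)) \<le> \<tau> * real (n p) * ln (real m)"
      using tau np p by (intro mult_left_mono) auto
    moreover have "real m = real (n p) + real k" using k by simp
    ultimately have "real k * ln (real k) + 2 * real k + (\<tau> * real (n p) * ln (real (n p)) + 3 * real (n p))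
      \<le> \<tau> * (real (n p) + real k) * ln (real m) + 3 * (real (n p) + real k)"
      by (simp add: algebra_simps)
    then show "exp (real k * ln (real k) + 2 * real k + (\<tau> * real (n p) * ln (real (n p)) + 3 * real (n p)))
       \<le> exp (\<tau> * real m * ln (real m) + 3 * real m)"
      using k by simp
  qed
  finally show ?thesis by (simp add: D_def)
qed

section \<open>Termwise bounds for rapidly decaying power series\<close>

text \<open>The bound is geometric in \<open>m\<close>, so it can be summed, while the constant in
  front carries the whole dependence on \<open>r\<close>.\<close>

lemma power_series_bound:
  fixes c :: "nat \<Rightarrow> real" and r s D :: real
  assumes s: "s > 0" and r: "r \<ge> 1" and D: "D \<ge> 0"
    and c: "\<And>m. c m \<le> D * exp (4 * real m - s * real m * ln (real m))"
  shows "c m * r ^ m \<le> D * exp ((exp 5 * r) powr (1/s) * (5 + ln r)) * exp (-1) ^ m"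
proof -
  \<comment> \<open>Up to the index \<open>X\<close> the decaying factor is ignored; beyond it the terms are at most \<open>D * exp (- m)\<close>.\<close>
  define X where "X = (exp 5 * r) powr (1/s)"
  have X: "X > 0" using r by (simp add: X_def)
  \<comment> \<open>In 5 = 4 + 1, the 4 cancels the linear term of the coefficient bound and the 1
    pays for the decay \<open>exp (-1) ^ m\<close>.\<close>
  have lnX: "s * ln X = 5 + ln r" using s r by (simp add: X_def ln_powr ln_mult)
  have key: "4 * real m - s * real m * ln (real m) + real m * ln r \<le> X * (5 + ln r) - real m"
  proof (cases "real m < X")
    case True
    have "real m * (5 + ln r) \<le> X * (5 + ln r)" using True r by (intro mult_right_mono) auto
    moreover have "s * real m * ln (real m) \<ge> 0" using s by (cases "m = 0") auto
    ultimately show ?thesis by (simp add: algebra_simps)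
  next
    case False
    then have "ln X \<le> ln (real m)" using X by simp
    then have "s * ln X \<le> s * ln (real m)" using s by simp
    then have "real m * (5 + ln r) \<le> real m * (s * ln (real m))" by (intro mult_left_mono) (auto simp: lnX)
    moreover have "X * (5 + ln r) \<ge> 0" using X r by simp
    ultimately show ?thesis by (simp add: algebra_simps)
  qed
  have "c m * r ^ m \<le> D * exp (4 * real m - s * real m * ln (real m)) * exp (real m * ln r)"
    using r c[of m] by (simp add: exp_of_nat_mult mult_right_mono)
  also have "\<dots> = D * exp (4 * real m - s * real m * ln (real m) + real m * ln r)"
    by (simp add: exp_add)
  also have "\<dots> \<le> D * exp (X * (5 + ln r) - real m)" using key D by (intro mult_left_mono) auto
  also have "\<dots> = D * exp (X * (5 + ln r)) * exp (-1) ^ m"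
    by (simp add: exp_diff exp_minus exp_of_nat_mult[of m "1::real", simplified] field_simps)
  finally show ?thesis by (simp add: X_def)
qed

section \<open>Taylor coefficients and uniqueness of the harmonic decomposition\<close>

lemma sums_imp_coeff_eq_higher_deriv:
  fixes A :: "nat \<Rightarrow> complex"
  assumes "r > 0" "\<And>z. z \<in> ball 0 r \<Longrightarrow> (\<lambda>n. A n * z ^ n) sums H z"
  shows "A n = (deriv ^^ n) H 0 / fact n"
proof -
  have "eventually (\<lambda>z. z \<in> ball 0 r) (nhds (0::complex))"
    using assms(1) by (intro eventually_nhds_in_open) auto
  then have "H has_fps_expansion Abs_fps A"
    using assms(2) by (intro has_fps_expansionI) (auto elim!: eventually_mono)
  then show ?thesis using fps_nth_fps_expansion[of H "Abs_fps A" n] by simp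
qed

text \<open>By the open mapping theorem the image of a nonconstant map would contain a point shifted
  in the real direction.\<close>

lemma holomorphic_Re_eq_0_imp_constant_on:
  assumes "f holomorphic_on S" "open S" "connected S" "\<And>z. z \<in> S \<Longrightarrow> Re (f z) = 0"
  shows "f constant_on S"
proof (rule ccontr)
  assume nc: "\<not> f constant_on S"
  then obtain z where z: "z \<in> S" by (auto simp: constant_on_def)
  have "open (f ` S)"
    using assms nc by (intro open_mapping_thm[of f S]) auto
  then obtain e where e: "e > 0" "ball (f z) e \<subseteq> f ` S"
    using z by (meson imageI open_contains_ball)
  have "f z + of_real (e/2) \<in> ball (f z) e" using e by (simp add: dist_norm)
  then obtain w where "w \<in> S" "f w = f z + of_real (e/2)" using e by (metis imageE subsetD)
  then show False using assms(4)[of w] assms(4)[of z] z e by simp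
qed

text \<open>With u = H1 - H2 and v = G2 - G1 the equation reads u = cnj v. Hence u - v is purely
  imaginary and u + v is real, so u - v and \<i> * (u + v) both have vanishing real part and are
  constant.\<close>

lemma harmonic_decomp_unique:
  assumes S: "open S" "connected S"
    and hol: "H1 holomorphic_on S" "G1 holomorphic_on S" "H2 holomorphic_on S" "G2 holomorphic_on S"
    and eq: "\<And>z. z \<in> S \<Longrightarrow> H1 z + cnj (G1 z) = H2 z + cnj (G2 z)"
  shows "(\<lambda>z. H1 z - H2 z) constant_on S" "(\<lambda>z. G1 z - G2 z) constant_on S"
proof -
  have eq': "H1 z - H2 z = cnj (G2 z - G1 z)" if "z \<in> S" for z
    using eq[OF that] by (simp add: algebra_simps)
  have "(\<lambda>z. (H1 z - H2 z) - (G2 z - G1 z)) constant_on S"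
    using S hol eq' by (intro holomorphic_Re_eq_0_imp_constant_on holomorphic_intros) auto
  moreover have "(\<lambda>z. \<i> * ((H1 z - H2 z) + (G2 z - G1 z))) constant_on S"
    using S hol eq' by (intro holomorphic_Re_eq_0_imp_constant_on holomorphic_intros) auto
  ultimately obtain u v where
    u: "\<And>z. z \<in> S \<Longrightarrow> (H1 z - H2 z) - (G2 z - G1 z) = u" and
    v: "\<And>z. z \<in> S \<Longrightarrow> \<i> * ((H1 z - H2 z) + (G2 z - G1 z)) = v"
    unfolding constant_on_def by metis
  have "H1 z - H2 z = (u - \<i> * v) / 2" "G1 z - G2 z = (u + \<i> * v) / 2" if "z \<in> S" for z
    unfolding u[OF that, symmetric] v[OF that, symmetric] by (simp_all add: algebra_simps)
  then show "(\<lambda>z. H1 z - H2 z) constant_on S" "(\<lambda>z. G1 z - G2 z) constant_on S"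
    unfolding constant_on_def by blast+
qed

lemma higher_deriv_eq_if_diff_constant_on:
  assumes "open S" "f holomorphic_on S" "g holomorphic_on S" "(\<lambda>z. f z - g z) constant_on S" "z \<in> S" "k \<ge> 1"
  shows "(deriv ^^ k) f z = (deriv ^^ k) g z"
proof -
  obtain c where c: "\<And>z. z \<in> S \<Longrightarrow> f z - g z = c" using assms(4) by (auto simp: constant_on_def)
  have "(deriv ^^ k) f z - (deriv ^^ k) g z = (deriv ^^ k) (\<lambda>w. f w - g w) z"
    by (rule higher_deriv_diff[symmetric]) (use assms in auto)
  also have "\<dots> = (deriv ^^ k) (\<lambda>w. c) z"
    using assms c by (intro higher_deriv_transform_within_open[of _ S] holomorphic_intros) auto
  finally show ?thesis using assms(6) by simp
qed

section \<open>Coefficient bounds from membership in \<open>SHc\<close>\<close>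

text \<open>The class bounds the coefficients of some decomposition of \<open>F\<close>; uniqueness
  up to constants transfers them to the given one. The bound (2 * k^2 + 1) / 3 is relaxed to
  k^2.\<close>

lemma SHc_coeff_bound:
  assumes F: "F \<in> SHc" and hol: "h holomorphic_on ball 0 1" "g holomorphic_on ball 0 1"
    and eq: "\<And>z. z \<in> ball 0 1 \<Longrightarrow> F z = h z + cnj (g z)" and k: "k \<ge> 2"
  shows "norm ((deriv ^^ k) h 0 / fact k) \<le> (real k)\<^sup>2" "norm ((deriv ^^ k) g 0 / fact k) \<le> (real k)\<^sup>2"
proof -
  from F obtain A B where AB: "SH_coeffs F A B"
    "norm (A k) < (2 * (real k)\<^sup>2 + 1) / 3" "norm (B k) < (2 * (real k)\<^sup>2 + 1) / 3"
    using k by (auto simp: SHc_def)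
  then obtain H G where HG: "sense_preserving (ball 0 1) F H G"
    "\<And>z. z \<in> ball 0 1 \<Longrightarrow> (\<lambda>n. A n * z ^ n) sums H z" "\<And>z. z \<in> ball 0 1 \<Longrightarrow> (\<lambda>n. B n * z ^ n) sums G z"
    by (auto simp: SH_coeffs_def)
  have HGd: "H holomorphic_on ball 0 1" "G holomorphic_on ball 0 1"
     "\<And>z. z \<in> ball 0 1 \<Longrightarrow> F z = H z + cnj (G z)"
    using HG(1) by (auto simp: sense_preserving_def harmonic_decomp_def)
  have "(\<lambda>z. h z - H z) constant_on ball 0 1" "(\<lambda>z. g z - G z) constant_on ball 0 1"
    using harmonic_decomp_unique[of "ball 0 1" h g H G] hol HGd eq by auto
  then have "(deriv ^^ k) h 0 = (deriv ^^ k) H 0" "(deriv ^^ k) g 0 = (deriv ^^ k) G 0"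
    using hol HGd k by (auto intro!: higher_deriv_eq_if_diff_constant_on[of "ball 0 1"])
  moreover have "A k = (deriv ^^ k) H 0 / fact k" "B k = (deriv ^^ k) G 0 / fact k"
    by (rule sums_imp_coeff_eq_higher_deriv[of 1]; use HG in simp)+
  moreover have "1 \<le> (real k)\<^sup>2" using k by (simp add: power2_eq_square mult_ge1_I)
  ultimately show "norm ((deriv ^^ k) h 0 / fact k) \<le> (real k)\<^sup>2" "norm ((deriv ^^ k) g 0 / fact k) \<le> (real k)\<^sup>2"
    using AB by auto
qed

lemma SHc_not_constant: "F \<in> SHc \<Longrightarrow> \<not> F constant_on ball 0 1"
  by (auto simp: SHc_def SH_coeffs_def sense_preserving_def)

text \<open>The quotient has Taylor coefficients (N + k)! * a (N + k) / (k! * K) and (N + k)! * b (N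
  + k) / (k! * cnj K), where |K| is (N + 1)! times the larger of the two moduli at
  \<open>N + 1\<close>. Everything is symmetric in \<open>h\<close> and \<open>g\<close>, so the
  conjugated case follows by exchanging them.\<close>

lemma derivative_in_SHc_imp_coeff_bound:
  fixes a b :: "nat \<Rightarrow> complex"
  assumes hol: "h holomorphic_on UNIV" "g holomorphic_on UNIV"
    and a: "\<And>z. (\<lambda>k. a k * z ^ k) sums h z" and b: "\<And>z. (\<lambda>k. b k * z ^ k) sums g z"
    and le: "norm (b (N + 1)) \<le> norm (a (N + 1))"
    and F: "(\<lambda>z. (harmonic_deriv N h g z - fact N * a N - fact N * cnj (b N))
                  / (fact (N + 1) * a (N + 1))) \<in> SHc"
    and k: "k \<ge> 1"
  shows "a (N + 1) \<noteq> 0"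
    and "fact (N + k) * max (norm (a (N + k))) (norm (b (N + k)))
       \<le> fact k * (real k)\<^sup>2 * (fact (N + 1) * max (norm (a (N + 1))) (norm (b (N + 1))))"
proof -
  define K :: complex where "K = fact (N + 1) * a (N + 1)"
  \<comment> \<open>Division by zero yields 0, so a vanishing \<open>a (N + 1)\<close> would make
    the quotient identically 0, whereas members of \<open>SHc\<close> are nonconstant.\<close>
  show "a (N + 1) \<noteq> 0"
    using SHc_not_constant[OF F] by (auto simp: constant_on_def)
  then have K: "K \<noteq> 0" by (simp add: K_def del: fact_Suc)
  define h' where "h' = (\<lambda>z. 1 / K * ((deriv ^^ N) h z - fact N * a N))"
  define g' where "g' = (\<lambda>z. 1 / cnj K * ((deriv ^^ N) g z - fact N * b N))"
  have hol': "(deriv ^^ N) h holomorphic_on UNIV" "(deriv ^^ N) g holomorphic_on UNIV"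
    using hol by (auto intro!: holomorphic_higher_deriv)
  have bound: "norm ((deriv ^^ k) h' 0 / fact k) \<le> (real k)\<^sup>2 \<and> norm ((deriv ^^ k) g' 0 / fact k) \<le> (real k)\<^sup>2" if "k \<ge> 2"
  proof -
    have "h' holomorphic_on ball 0 1" "g' holomorphic_on ball 0 1"
      unfolding h'_def g'_def by (intro holomorphic_intros holomorphic_on_subset[OF hol'(1)] holomorphic_on_subset[OF hol'(2)] subset_UNIV)+
    moreover have "(harmonic_deriv N h g z - fact N * a N - fact N * cnj (b N)) / (fact (N + 1) * a (N + 1))
        = h' z + cnj (g' z)" for z
      unfolding h'_def g'_def harmonic_deriv_def K_def[symmetric] using K by (simp add: field_simps)
    ultimately show ?thesis using SHc_coeff_bound[OF F _ _ _ that, of h' g'] by blast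
  qed
  \<comment> \<open>Stated for generic \<open>u\<close>, \<open>c\<close> and \<open>C\<close>, to
    be used both for \<open>h\<close> with \<open>K\<close> and for \<open>g\<close> with
    \<open>cnj K\<close>.\<close>
  have coeff: "norm ((deriv ^^ k) (\<lambda>z. 1 / C * ((deriv ^^ N) u z - fact N * c N)) 0)
      = fact (N + k) * norm (c (N + k)) / norm C"
    if "u holomorphic_on UNIV" "\<And>z. (\<lambda>k. c k * z ^ k) sums u z" for C u and c :: "nat \<Rightarrow> complex"
  proof -
    have holu: "(deriv ^^ N) u holomorphic_on UNIV" using that by (auto intro!: holomorphic_higher_deriv)
    have "(deriv ^^ k) (\<lambda>z. 1 / C * ((deriv ^^ N) u z - fact N * c N)) 0
        = 1 / C * (deriv ^^ k) (\<lambda>z. (deriv ^^ N) u z - fact N * c N) 0"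
      by (rule higher_deriv_cmult[of _ UNIV]) (auto intro!: holomorphic_intros holu)
    also have "(deriv ^^ k) (\<lambda>z. (deriv ^^ N) u z - fact N * c N) 0 = (deriv ^^ k) ((deriv ^^ N) u) 0"
      by (rule higher_deriv_eq_if_diff_constant_on[of UNIV])
         (use k in \<open>auto intro!: holomorphic_intros holu simp: constant_on_def\<close>)
    also have "\<dots> = (deriv ^^ (N + k)) u 0" by (simp only: add.commute[of N k] funpow_add o_apply)
    also have "\<dots> = fact (N + k) * c (N + k)"
      using sums_imp_coeff_eq_higher_deriv[of 1 c u "N + k"] that by simp
    finally show ?thesis by (simp add: norm_mult norm_divide)
  qed
  show "fact (N + k) * max (norm (a (N + k))) (norm (b (N + k)))
       \<le> fact k * (real k)\<^sup>2 * (fact (N + 1) * max (norm (a (N + 1))) (norm (b (N + 1))))"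
  \<comment> \<open>The class bounds coefficients from index 2 on; for \<open>k = 1\<close> both
    sides agree.\<close>
  proof (cases "k = 1")
    case False
    then have "k \<ge> 2" using k by simp
    have nK: "norm K > 0" using K by simp
    have "fact (N + k) * norm (a (N + k)) \<le> fact k * (real k)\<^sup>2 * norm K"
      "fact (N + k) * norm (b (N + k)) \<le> fact k * (real k)\<^sup>2 * norm K"
      using bound[OF \<open>k \<ge> 2\<close>] coeff[OF hol(1) a, of K] coeff[OF hol(2) b, of "cnj K"] nK
      by (auto simp: h'_def g'_def norm_divide field_simps)
    moreover have "norm K = fact (N + 1) * max (norm (a (N + 1))) (norm (b (N + 1)))"
      using le by (simp add: K_def norm_mult max_def del: fact_Suc)
    ultimately show ?thesis by (simp add: max_def)
  qed simp
qed

section \<open>Unboundedness of nonconstant harmonic entire mappings\<close>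

text \<open>A bound on arbitrarily large circles is all that the negation of an eventual statement
  provides. The maximum principle extends it to the plane, Liouville makes \<open>exp (f z)\<close>
  constant, and differentiating gives \<open>deriv f = 0\<close>.\<close>

lemma entire_Re_bounded_imp_constant_on:
  assumes hol: "f holomorphic_on UNIV" and "\<And>R. \<exists>r\<ge>R. \<forall>z\<in>sphere 0 r. Re (f z) \<le> B"
  shows "f constant_on UNIV"
proof -
  have "Re (f w) \<le> B" for w
  proof -
    obtain r where r: "r \<ge> norm w + 1" "\<And>z. z \<in> sphere 0 r \<Longrightarrow> Re (f z) \<le> B"
      using assms(2) by blast
    show ?thesis
    proof (rule maximum_real_frontier[of f "ball 0 r"])
      show "continuous_on (closure (ball 0 r)) f"
        using hol holomorphic_on_imp_continuous_on holomorphic_on_subset by blast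
      show "Re (f z) \<le> B" if "z \<in> frontier (ball 0 r)" for z
        using r that frontier_ball[of r 0] norm_ge_zero[of w] by auto
    qed (use r hol holomorphic_on_subset in auto)
  qed
  then have "bounded (range (\<lambda>z. exp (f z)))"
    by (auto simp: bounded_iff intro!: exI[of _ "exp B"])
  then have "(\<lambda>z. exp (f z)) constant_on UNIV"
    using hol by (intro Liouville_theorem holomorphic_intros)
  then obtain c where c: "\<And>z. exp (f z) = c" by (auto simp: constant_on_def)
  have "deriv f z = 0" for z
  proof -
    have "((\<lambda>z. exp (f z)) has_field_derivative exp (f z) * deriv f z) (at z)"
      using hol by (auto intro!: derivative_eq_intros holomorphic_derivI)
    moreover have "((\<lambda>z. exp (f z)) has_field_derivative 0) (at z)" by (simp add: c)
    ultimately have "exp (f z) * deriv f z = 0" by (rule DERIV_unique)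
    then show ?thesis by simp
  qed
  then have "\<And>z. (f has_field_derivative 0) (at z)"
    using hol by (metis UNIV_I holomorphic_derivI open_UNIV)
  then show ?thesis
    using has_field_derivative_zero_constant[of UNIV f] by (auto simp: constant_on_def)
qed

text \<open>Keeps \<open>ln (max_modulus r f)\<close> above 1 for large \<open>r\<close>, where the
  iterated logarithm is monotone.\<close>

lemma harmonic_entire_unbounded:
  assumes he: "harmonic_entire f h g" and nc: "\<not> (h constant_on UNIV \<and> g constant_on UNIV)"
  shows "eventually (\<lambda>r. max_modulus r f > B) at_top"
proof (rule ccontr)
  have hol: "h holomorphic_on UNIV" "g holomorphic_on UNIV" and f: "\<And>z. f z = h z + cnj (g z)"
    using he by (auto simp: harmonic_entire_def harmonic_decomp_def)
  assume "\<not> eventually (\<lambda>r. max_modulus r f > B) at_top"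
  then have fr: "\<exists>r\<ge>R. max_modulus r f \<le> B" for R
    by (auto simp: eventually_at_top_linorder not_less)
  have contf: "continuous_on UNIV f"
    unfolding f by (intro continuous_intros holomorphic_on_imp_continuous_on hol)
  have le: "norm (f z) \<le> max_modulus r f" if "z \<in> sphere 0 r" for z r
    unfolding max_modulus_def
  proof (rule cSUP_upper[OF that])
    have "compact ((\<lambda>z. norm (f z)) ` sphere 0 r)"
      by (intro compact_continuous_image continuous_intros continuous_on_subset[OF contf]) auto
    then show "bdd_above ((\<lambda>z. norm (f z)) ` sphere 0 r)"
      by (intro bounded_imp_bdd_above compact_imp_bounded)
  qed
  \<comment> \<open>The real parts of \<open>h + g\<close> and \<open>-\<i> * (h - g)\<close> are \<open>Re f\<close> and \<open>Im f\<close>.\<close>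
  have "(\<lambda>z. h z + g z) constant_on UNIV"
  proof (rule entire_Re_bounded_imp_constant_on[of _ B])
    show "\<exists>r\<ge>R. \<forall>z\<in>sphere 0 r. Re (h z + g z) \<le> B" for R
    proof -
      obtain r where r: "r \<ge> R" "max_modulus r f \<le> B" using fr by blast
      have "Re (h z + g z) \<le> B" if "z \<in> sphere 0 r" for z
        using le[OF that] r complex_Re_le_cmod[of "f z"] by (simp add: f)
      then show ?thesis using r by blast
    qed
  qed (intro holomorphic_intros hol)
  moreover have "(\<lambda>z. -\<i> * (h z - g z)) constant_on UNIV"
  proof (rule entire_Re_bounded_imp_constant_on[of _ B])
    show "\<exists>r\<ge>R. \<forall>z\<in>sphere 0 r. Re (-\<i> * (h z - g z)) \<le> B" for R
    proof -
      obtain r where r: "r \<ge> R" "max_modulus r f \<le> B" using fr by blast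
      have "Re (-\<i> * (h z - g z)) \<le> B" if "z \<in> sphere 0 r" for z
        using le[OF that] r abs_Im_le_cmod[of "f z"] by (simp add: f)
      then show ?thesis using r by blast
    qed
  qed (intro holomorphic_intros hol)
  ultimately obtain u v where u: "\<And>z. h z + g z = u" and v: "\<And>z. -\<i> * (h z - g z) = v"
    unfolding constant_on_def by auto
  have "h z = (u + \<i> * v) / 2" "g z = (u - \<i> * v) / 2" for z
    unfolding u[of z, symmetric] v[of z, symmetric] by (simp_all add: algebra_simps)
  then show False using nc unfolding constant_on_def by metis
qed

section \<open>From coefficient decay to the order of growth\<close>

text \<open>The 4 is a factor 2 for the two series times the bound 1 / (1 - exp (-1)) <= 2 for the
  geometric sum.\<close>

lemma max_modulus_power_series_le:
  fixes a b :: "nat \<Rightarrow> complex"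
  assumes f: "\<And>z. f z = h z + cnj (g z)"
    and a: "\<And>z. (\<lambda>k. a k * z ^ k) sums h z" and b: "\<And>z. (\<lambda>k. b k * z ^ k) sums g z"
    and r: "r \<ge> 0"
    and le: "\<And>m. max (norm (a m)) (norm (b m)) * r ^ m \<le> C * exp (-1) ^ m"
  shows "max_modulus r f \<le> 4 * C"
proof -
  have q: "exp (-1) < (1::real)" "1 / (1 - exp (-1)) \<le> (2::real)"
    using exp_ge_add_one_self[of "1::real"] by (auto simp: exp_minus field_simps)
  have C: "C \<ge> 0" using le[of 0] order_trans[OF norm_ge_zero[of "a 0"], of C] by simp
  have geo: "(\<lambda>m. C * exp (-1) ^ m) sums (C * (1 / (1 - exp (-1))))"
    using q by (intro sums_mult geometric_sums) auto
  have part: "norm (u z) \<le> 2 * C"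
    if c: "\<And>z. (\<lambda>k. c k * z ^ k) sums u z" "\<And>m. norm (c m) \<le> max (norm (a m)) (norm (b m))" "norm z = r"
    for c :: "nat \<Rightarrow> complex" and u z
  proof -
    have "norm (c m * z ^ m) \<le> C * exp (-1) ^ m" for m
      using order_trans[OF mult_right_mono[OF c(2)] le[of m]] c(3) r by (simp add: norm_mult norm_power)
    then have "norm (\<Sum>m. c m * z ^ m) \<le> (\<Sum>m. C * exp (-1) ^ m)"
      by (rule norm_suminf_le) (use geo in \<open>simp add: sums_iff\<close>)
    also have "\<dots> \<le> C * 2" using geo mult_left_mono[OF q(2) C] by (simp add: sums_iff)
    finally show ?thesis using c(1)[of z] by (simp add: sums_iff)
  qed
  have "norm (f z) \<le> 4 * C" if "z \<in> sphere 0 r" for z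
    using part[OF a, of z] part[OF b, of z] that norm_triangle_ineq[of "h z" "cnj (g z)"] by (simp add: f)
  then show ?thesis unfolding max_modulus_def
    using r by (intro cSUP_least) (auto intro: exI[of _ "of_real r"])
qed

text \<open>The maximum modulus is eventually at most \<open>E r\<close>, and
  \<open>ln (ln (E r))\<close> equals \<open>ln r / s\<close> up to O(ln (ln r)).\<close>

lemma growth_order_le:
  fixes a b :: "nat \<Rightarrow> complex"
  assumes he: "harmonic_entire f h g" and nc: "\<not> (h constant_on UNIV \<and> g constant_on UNIV)"
    and a: "\<And>z. (\<lambda>k. a k * z ^ k) sums h z" and b: "\<And>z. (\<lambda>k. b k * z ^ k) sums g z"
    and s: "s > 0" and D: "D > 0"
    and c: "\<And>m. max (norm (a m)) (norm (b m)) \<le> D * exp (4 * real m - s * real m * ln (real m))"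
  shows "growth_order f \<le> ereal (1 / s)"
proof -
  define E where "E = (\<lambda>r. 4 * D * exp ((exp 5 * r) powr (1/s) * (5 + ln r)))"
  have "((\<lambda>r. ln (ln (E r)) / ln r) \<longlongrightarrow> 1/s) at_top"
    unfolding E_def using s D by real_asymp
  then have "Limsup at_top (\<lambda>r. ereal (ln (ln (E r)) / ln r)) = ereal (1/s)"
    by (intro lim_imp_Limsup) auto
  moreover have "growth_order f \<le> Limsup at_top (\<lambda>r. ereal (ln (ln (E r)) / ln r))"
    unfolding growth_order_def
  proof (rule Limsup_mono)
    show "\<forall>\<^sub>F r in at_top. ereal (ln (ln (max_modulus r f)) / ln r) \<le> ereal (ln (ln (E r)) / ln r)"
      using harmonic_entire_unbounded[OF he nc, of "exp 1"] eventually_gt_at_top[of 1]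
    proof eventually_elim
      case (elim r)
      define M where "M = max_modulus r f"
      have "M \<le> 4 * (D * exp ((exp 5 * r) powr (1/s) * (5 + ln r)))"
        unfolding M_def
      proof (rule max_modulus_power_series_le[OF _ a b])
        show "f z = h z + cnj (g z)" for z
          using he by (simp add: harmonic_entire_def harmonic_decomp_def)
      qed (use power_series_bound[OF s _ _ c] elim D in auto)
      then have ME: "M \<le> E r" by (simp add: E_def)
      \<comment> \<open>This gives \<open>ln M > 1\<close>, so both logarithms can be applied to
        \<open>M \<le> E r\<close> monotonically; \<open>r > 1\<close> keeps \<open>ln r\<close>
        positive.\<close>
      have M: "M > exp 1" using elim by (simp add: M_def)
      then have M0: "M > 0" by (rule less_trans[rotated]) simp
      have "ln M > 1" using M M0 ln_less_cancel_iff[of "exp 1" M] by simp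
      moreover have "ln M \<le> ln (E r)" using ME M0 by simp
      ultimately have "ln (ln M) \<le> ln (ln (E r))" by simp
      then show ?case using elim by (simp add: M_def divide_right_mono)
    qed
  qed
  ultimately show ?thesis by simp
qed

section \<open>Coefficient decay and the gap condition\<close>

text \<open>Beyond \<open>n P\<close>, \<open>gap_growth\<close> bounds \<open>m! * c m\<close>, and
  dividing by m! >= m^m * exp (-m) turns \<tau> into \<tau> - 1 and the linear constant 3 into
  4.\<close>

lemma coeff_decay:
  fixes c :: "nat \<Rightarrow> real" and n :: "nat \<Rightarrow> nat"
  assumes c0: "\<And>m. c m \<ge> 0"
    and mono: "\<And>p. p \<ge> P \<Longrightarrow> n p < n (Suc p)"
    and pos: "n P > 0"
    and step: "\<And>p k. p \<ge> P \<Longrightarrow> k \<ge> 1 \<Longrightarrow>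
        fact (n p + k) * c (n p + k) \<le> fact k * (real k)\<^sup>2 * (fact (n p + 1) * c (n p + 1))"
    and gap: "\<And>p. p \<ge> P \<Longrightarrow> ln (real (n (Suc p) - n p)) \<le> \<tau> * ln (real (n (Suc p)))"
    and dbl: "\<And>p. p \<ge> P \<Longrightarrow> n (Suc p) \<le> 2 * n p"
    and tau: "0 \<le> \<tau>" "\<tau> \<le> 1"
  obtains D where "D > 0" "\<And>m. c m \<le> D * exp (4 * real m - (1 - \<tau>) * real m * ln (real m))"
proof -
  define w where "w = (\<lambda>m. exp (4 * real m - (1 - \<tau>) * real m * ln (real m)))"
  \<comment> \<open>The 1 makes \<open>D\<close> positive, the next summand is the constant of
    \<open>gap_growth\<close>, and the sum covers the finitely many
    \<open>m \<le> n P\<close>.\<close>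
  define D where "D = 1 + fact (n P + 1) * c (n P + 1) + (\<Sum>m\<le>n P. c m / w m)"
  have w: "w m > 0" for m by (simp add: w_def)
  have sum0: "(\<Sum>m\<le>n P. c m / w m) \<ge> 0" using c0 w by (intro sum_nonneg divide_nonneg_pos) auto
  have d0: "fact (n P + 1) * c (n P + 1) \<ge> 0" using c0 by (intro mult_nonneg_nonneg) auto
  have "c m \<le> D * w m" for m
  proof (cases "m \<le> n P")
    case True
    have "c m / w m \<le> (\<Sum>m\<le>n P. c m / w m)"
      using c0 w True by (intro member_le_sum divide_nonneg_pos) auto
    also have "\<dots> \<le> D" using d0 by (simp add: D_def)
    finally show ?thesis using w[of m] by (simp add: field_simps)
  next
    case False
    then have m: "m > 0" "n P < m" using pos by auto
    have "fact m * c m \<le> fact (n P + 1) * c (n P + 1) * exp (\<tau> * real m * ln (real m) + 3 * real m)"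
      using m(2) c0 by (intro gap_growth[where d = "\<lambda>m. fact m * c m"] mono pos step gap dbl tau) auto
    also have "\<dots> \<le> D * exp (\<tau> * real m * ln (real m) + 3 * real m)"
      using sum0 by (intro mult_right_mono) (auto simp: D_def)
    finally have 1: "fact m * c m \<le> D * exp (\<tau> * real m * ln (real m) + 3 * real m)" .
    have "exp (real m * ln (real m)) * c m = real m ^ m * c m"
      using m by (simp add: exp_of_nat_mult)
    also have "\<dots> \<le> exp (real m) * fact m * c m"
      by (intro mult_right_mono power_fact_le_exp c0)
    also have "\<dots> \<le> exp (real m) * (D * exp (\<tau> * real m * ln (real m) + 3 * real m))"
      using 1 by (simp add: mult.assoc)
    finally have "c m \<le> exp (real m) * (D * exp (\<tau> * real m * ln (real m) + 3 * real m)) / exp (real m * ln (real m))"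
      by (simp add: field_simps)
    also have "\<dots> = D * exp (real m + (\<tau> * real m * ln (real m) + 3 * real m) - real m * ln (real m))"
      by (simp only: exp_add exp_diff times_divide_eq_right mult_ac)
    also have "real m + (\<tau> * real m * ln (real m) + 3 * real m) - real m * ln (real m)
        = 4 * real m - (1 - \<tau>) * real m * ln (real m)" by (simp add: algebra_simps)
    finally show ?thesis by (simp add: w_def)
  qed
  moreover have "D > 0" using sum0 d0 by (simp add: D_def)
  ultimately show ?thesis using that by (auto simp: w_def)
qed

text \<open>Confines \<open>L\<close> to [0, 1], so that it is a real number below 1 unless it
  equals 1.\<close>

lemma gap_ratio_limsup_bounds:
  fixes n :: "nat \<Rightarrow> nat"
  assumes "strict_mono_on {1..} n"
  defines "L \<equiv> limsup (\<lambda>p. ereal (ln (real (n p) - real (n (p - 1))) / ln (real (n p))))"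
  shows "0 \<le> L" "L \<le> 1"
proof -
  have ev: "\<forall>\<^sub>F p in sequentially.
     0 \<le> ereal (ln (real (n p) - real (n (p - 1))) / ln (real (n p))) \<and>
     ereal (ln (real (n p) - real (n (p - 1))) / ln (real (n p))) \<le> 1"
    using eventually_ge_at_top[of 4]
  proof eventually_elim
    case (elim p)
    \<comment> \<open>Monotonicity holds on \<open>{1..}\<close> only and \<open>n 0\<close> is
      arbitrary, so \<open>p - 1\<close> has to be at least 1.\<close>
    have "n (p - 1) < n p" using strict_mono_onD[OF assms(1), of "p - 1" p] elim by auto
    then have "real (n p) - real (n (p - 1)) \<ge> 1" "n p \<ge> 1" by linarith+
    moreover from this have "ln (real (n p) - real (n (p - 1))) \<le> ln (real (n p))"
      by (subst ln_le_cancel_iff) auto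
    ultimately show ?case by (auto simp: divide_le_eq_1 intro!: divide_nonneg_nonneg)
  qed
  show "0 \<le> L" unfolding L_def by (rule le_Limsup) (use ev in \<open>auto elim: eventually_mono\<close>)
  show "L \<le> 1" unfolding L_def by (rule Limsup_bounded) (use ev in \<open>auto elim: eventually_mono\<close>)
qed

text \<open>Doubling follows from the gap bound: with N = n (Suc p) the gap is at most N powr
  \<tau>, which is at most N / 2 for large N because \<tau> < 1.\<close>

lemma gap_ratio_eventually:
  fixes n :: "nat \<Rightarrow> nat"
  assumes sm: "strict_mono_on {1..} n"
    and lim: "limsup (\<lambda>p. ereal (ln (real (n p) - real (n (p - 1))) / ln (real (n p)))) < ereal \<tau>"
    and tau: "\<tau> < 1"
  obtains P where "P \<ge> 1" "n P > 0"
    "\<And>p. p \<ge> P \<Longrightarrow> ln (real (n (Suc p) - n p)) \<le> \<tau> * ln (real (n (Suc p)))"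
    "\<And>p. p \<ge> P \<Longrightarrow> n (Suc p) \<le> 2 * n p"
proof -
  \<comment> \<open>This is 2 powr (1 / (1 - \<tau>)), from which on N powr \<tau> <= N / 2.\<close>
  define x0 where "x0 = exp (ln 2 / (1 - \<tau>))"
  have x0_pos: "x0 > 0" by (simp add: x0_def)
  have mono: "n p < n (Suc p)" if "p \<ge> 1" for p
    using strict_mono_onD[OF sm, of p "Suc p"] that by auto
  have ge: "n (Suc p) \<ge> p" for p
    by (induction p) (use mono in \<open>auto intro: Suc_leI le_less_trans\<close>)
  have "\<forall>\<^sub>F p in sequentially. ln (real (n p) - real (n (p - 1))) / ln (real (n p)) < \<tau>"
    using Limsup_lessD[OF lim] by simp
  then obtain Q where Q: "\<And>p. p \<ge> Q \<Longrightarrow> ln (real (n p) - real (n (p - 1))) / ln (real (n p)) < \<tau>"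
    by (auto simp: eventually_sequentially)
  \<comment> \<open>Beyond \<open>Q\<close> the ratio is below \<tau>; since n (Suc p) >= p, the 3
    makes \<open>ln (n (Suc p))\<close> positive and the ceiling takes \<open>n (Suc p)\<close> past
    \<open>x0\<close>.\<close>
  define P where "P = Q + 3 + nat \<lceil>x0\<rceil>"
  have big: "real (n (Suc p)) \<ge> x0" "n (Suc p) \<ge> 3" if "p \<ge> P" for p
  proof -
    have "real p \<ge> x0" using that unfolding P_def by linarith
    then show "real (n (Suc p)) \<ge> x0" using ge[of p] by linarith
    show "n (Suc p) \<ge> 3" using ge[of p] that unfolding P_def by linarith
  qed
  have gap: "ln (real (n (Suc p) - n p)) \<le> \<tau> * ln (real (n (Suc p)))" if p: "p \<ge> P" for p
  proof -
    have "ln (real (n (Suc p))) > 0" using big[OF p] by simp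
    moreover have "real (n (Suc p) - n p) = real (n (Suc p)) - real (n p)"
      using mono[of p] p by (simp add: P_def of_nat_diff)
    moreover have "ln (real (n (Suc p)) - real (n p)) / ln (real (n (Suc p))) < \<tau>"
      using Q[of "Suc p"] p by (simp add: P_def)
    ultimately show ?thesis by (simp add: field_simps)
  qed
  have "n (Suc p) \<le> 2 * n p" if p: "p \<ge> P" for p
  proof -
    have N: "real (n (Suc p)) > 0" using big[OF p] by simp
    have "ln x0 \<le> ln (real (n (Suc p)))" using big(1)[OF p] N by (simp add: ln_le_cancel_iff[of x0] x0_pos)
    then have "ln 2 \<le> (1 - \<tau>) * ln (real (n (Suc p)))"
      using tau by (simp add: x0_def field_simps)
    then have "ln (real (n (Suc p) - n p)) \<le> ln (real (n (Suc p)) / 2)"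
      using gap[OF p] N by (simp add: ln_div algebra_simps)
    moreover have "real (n (Suc p) - n p) > 0" using mono[of p] p by (simp add: P_def)
    ultimately have "real (n (Suc p) - n p) \<le> real (n (Suc p)) / 2" using N by simp
    then show ?thesis by linarith
  qed
  moreover have "n P > 0" using mono[of "Q + 2 + nat \<lceil>x0\<rceil>"] by (simp add: P_def eval_nat_numeral)
  ultimately show ?thesis using gap by (intro that[of P]) (auto simp: P_def)
qed

section \<open>The order bound for each \<tau> above \<open>L\<close>, and the passage to the
  limit\<close>

theorem theorem8:
  fixes f h g :: "complex \<Rightarrow> complex"
    and a b :: "nat \<Rightarrow> complex"
    and n :: "nat \<Rightarrow> nat"
    and \<rho> L :: ereal
  assumes "harmonic_entire f h g"
    and "\<And>z. (\<lambda>k. a k * z ^ k) sums h z"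
    and "b 0 = 0"
    and "\<And>z. (\<lambda>k. b k * z ^ k) sums g z"
    and "growth_order f = \<rho>"
    and "strict_mono_on {1..} n"
    and "\<And>p. p \<ge> 1 \<Longrightarrow> norm (a (n p + 1)) \<ge> norm (b (n p + 1)) \<Longrightarrow>
           (\<lambda>z. (harmonic_deriv (n p) h g z - fact (n p) * a (n p) - fact (n p) * cnj (b (n p)))
                  / (fact (n p + 1) * a (n p + 1))) \<in> SHc"
    and "\<And>p. p \<ge> 1 \<Longrightarrow> norm (a (n p + 1)) \<le> norm (b (n p + 1)) \<Longrightarrow>
           (\<lambda>z. (cnj (harmonic_deriv (n p) h g z) - fact (n p) * cnj (a (n p)) - fact (n p) * b (n p))
                  / (fact (n p + 1) * b (n p + 1))) \<in> SHc"
    and "L = limsup (\<lambda>p. ereal (ln (real (n p) - real (n (p - 1))) / ln (real (n p))))"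
  shows "\<rho> \<le> (if L = 1 then \<infinity> else 1 / (1 - L))"
proof -
  define c where "c = (\<lambda>m. max (norm (a m)) (norm (b m)))"
  have hol: "h holomorphic_on UNIV" "g holomorphic_on UNIV"
    using assms(1) by (auto simp: harmonic_entire_def harmonic_decomp_def)
  \<comment> \<open>Positivity is recorded in order to exclude constant \<open>h\<close> and
    \<open>g\<close> below.\<close>
  have step: "c (n p + 1) > 0 \<and>
      fact (n p + k) * c (n p + k) \<le> fact k * (real k)\<^sup>2 * (fact (n p + 1) * c (n p + 1))"
    if p: "p \<ge> 1" and k: "k \<ge> 1" for p k
  proof (cases "norm (b (n p + 1)) \<le> norm (a (n p + 1))")
    case True
    show ?thesis
      using derivative_in_SHc_imp_coeff_bound[OF hol assms(2,4) True assms(7)[OF p True] k]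
      by (auto simp: c_def less_max_iff_disj)
  next
    case False
    then have le: "norm (a (n p + 1)) \<le> norm (b (n p + 1))" by simp
    \<comment> \<open>Conjugating the harmonic derivative exchanges \<open>h\<close> and
      \<open>g\<close>.\<close>
    have "(\<lambda>z. (harmonic_deriv (n p) g h z - fact (n p) * b (n p) - fact (n p) * cnj (a (n p)))
                  / (fact (n p + 1) * b (n p + 1))) \<in> SHc"
      using assms(8)[OF p le] by (simp add: harmonic_deriv_def algebra_simps)
    from derivative_in_SHc_imp_coeff_bound[OF hol(2,1) assms(4,2) le this k] show ?thesis
      by (auto simp: c_def less_max_iff_disj max.commute)
  qed
  have coeff0: "u m = 0" if v: "v constant_on UNIV" "\<And>z. (\<lambda>k. u k * z ^ k) sums v z" "m > 0"
    for u :: "nat \<Rightarrow> complex" and v m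
  proof -
    obtain w where w: "v = (\<lambda>_. w)" using v by (auto simp: constant_on_def fun_eq_iff)
    have "u m = (deriv ^^ m) v 0 / fact m"
      by (rule sums_imp_coeff_eq_higher_deriv[of 1]) (use v in auto)
    then show ?thesis unfolding w using \<open>m > 0\<close> by simp
  qed
  have nc: "\<not> (h constant_on UNIV \<and> g constant_on UNIV)"
  proof
    assume "h constant_on UNIV \<and> g constant_on UNIV"
    then have "c (n 1 + 1) = 0"
      using coeff0[OF _ assms(2)] coeff0[OF _ assms(4)] by (simp add: c_def)
    then show False using step[of 1 1] by simp
  qed
  have order: "\<rho> \<le> ereal (1 / (1 - \<tau>))" if tau: "0 \<le> \<tau>" "\<tau> < 1" "L < ereal \<tau>" for \<tau>
  proof -
    obtain P where P: "P \<ge> 1" "n P > 0"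
      "\<And>p. p \<ge> P \<Longrightarrow> ln (real (n (Suc p) - n p)) \<le> \<tau> * ln (real (n (Suc p)))"
      "\<And>p. p \<ge> P \<Longrightarrow> n (Suc p) \<le> 2 * n p"
      by (rule gap_ratio_eventually[OF assms(6) tau(3)[unfolded assms(9)] tau(2)]) blast
    obtain D where D: "D > 0" "\<And>m. c m \<le> D * exp (4 * real m - (1 - \<tau>) * real m * ln (real m))"
    proof (rule coeff_decay[where P = P and n = n and c = c and \<tau> = \<tau>])
      show "n p < n (Suc p)" if "p \<ge> P" for p
        using strict_mono_onD[OF assms(6), of p "Suc p"] that P(1) by auto
      show "fact (n p + k) * c (n p + k) \<le> fact k * (real k)\<^sup>2 * (fact (n p + 1) * c (n p + 1))"
        if "p \<ge> P" "k \<ge> 1" for p k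
        using step[of p k] that P(1) by linarith
    qed (use P(2-4) tau in \<open>simp_all add: c_def le_max_iff_disj\<close>)
    show ?thesis
      using growth_order_le[OF assms(1) nc assms(2,4), of "1 - \<tau>" D] D tau assms(5) by (simp add: c_def)
  qed
  have L: "0 \<le> L" "L \<le> 1" unfolding assms(9) by (rule gap_ratio_limsup_bounds[OF assms(6)])+
  show ?thesis
  proof (cases "L = 1")
    case False
    then obtain l where l: "L = ereal l" "0 \<le> l" "l < 1" using L by (cases L) auto
    have "\<rho> \<le> ereal (1 / (1 - l)) + ereal e" if "e > 0" for e
    proof -
      \<comment> \<open>The choice \<tau> = 1 - 1 / y makes 1 / (1 - \<tau>) equal to
        \<open>y\<close>; \<tau> exceeds \<open>l\<close> because \<open>y > 1 / (1 - l)\<close>,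
        and it lies in (0, 1) because \<open>y > 1\<close>.\<close>
      define y where "y = 1 / (1 - l) + e"
      have y: "y > 1 / (1 - l)" using that by (simp add: y_def)
      have "1 / (1 - l) \<ge> 1" using l by simp
      then have y1: "y > 1" using y by linarith
      have "1 / y < 1 - l" using y l y1 by (simp add: field_simps)
      then have "\<rho> \<le> ereal (1 / (1 - (1 - 1 / y)))"
        using y1 l by (intro order) auto
      then show ?thesis by (simp add: y_def)
    qed
    then have "\<rho> \<le> ereal (1 / (1 - l))" by (rule ereal_le_epsilon2)
    then show ?thesis using l by (simp add: one_ereal_def)
  qed simp
qed

end
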